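(* Let $\mathcal{C}$ be a finite abstract simplicial complex. Then there exists a tuple $\rho$ of positive integers such that $\mathcal{C}$ is isomorphic to $\mathcal{S}(\rho)$ as an abstract simplicial complex.
   Context: A finite abstract simplicial complex is a collection of subsets (faces) of a finite vertex set that is closed under taking subsets and contains all singletons of vertices. For a tuple $\rho = (a_0,\ldots,a_N)$ of positive integers, $\mathcal{S}(\rho)$ is the abstract simplicial complex whose faces are the subsets $I \subset \{0,\ldots,N\}$ with $\gcd_{i \in I}(a_i) > 1$ (the empty set is regarded as a face); thus its vertices are the indices $i$ with $a_i > 1$. *)

theory Defs
  imports Main
begin

text \<open>
  A complex is given by its vertex set \<open>V\<close> and its set of faces \<open>K\<close>.  The empty set is always
  a face; for nonempty \<open>V\<close> this already follows from the other conditions, so the clause only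
  rules out the void collection over the empty vertex set.
\<close>

definition finite_simplicial_complex :: "'a set \<Rightarrow> 'a set set \<Rightarrow> bool" where
  "finite_simplicial_complex V K \<longleftrightarrow>
     finite V \<and> (\<forall>F\<in>K. F \<subseteq> V) \<and> {} \<in> K \<and>
     (\<forall>v\<in>V. {v} \<in> K) \<and>
     (\<forall>F\<in>K. \<forall>G. G \<subseteq> F \<longrightarrow> G \<in> K)"

definition complex_isomorphic ::
    "'a set \<Rightarrow> 'a set set \<Rightarrow> 'b set \<Rightarrow> 'b set set \<Rightarrow> bool" where
  "complex_isomorphic V K W L \<longleftrightarrow>
     (\<exists>f. bij_betw f V W \<and> (\<forall>F. F \<subseteq> V \<longrightarrow> (F \<in> K \<longleftrightarrow> f ` F \<in> L)))"

text \<open>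
  A tuple \<open>(a\<^sub>0, \<dots>, a\<^sub>N)\<close> of positive integers is a nonempty list \<open>\<rho>\<close> of positive naturals, with
  \<open>a\<^sub>i = \<rho> ! i\<close>.
\<close>

definition positive_tuple :: "nat list \<Rightarrow> bool" where
  "positive_tuple \<rho> \<longleftrightarrow> \<rho> \<noteq> [] \<and> (\<forall>a\<in>set \<rho>. 0 < a)"

text \<open>
  The disjunct \<open>I = {}\<close> is needed because the library's gcd of the empty family is \<open>0\<close>.
\<close>

definition S_faces :: "nat list \<Rightarrow> nat set set" where
  "S_faces \<rho> = {I. I \<subseteq> {..<length \<rho>} \<and> (I = {} \<or> (GCD i\<in>I. \<rho> ! i) > 1)}"

definition S_verts :: "nat list \<Rightarrow> nat set" where
  "S_verts \<rho> = {i. i < length \<rho> \<and> \<rho> ! i > 1}"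

lemma S_complex:
  assumes "positive_tuple \<rho>"
  shows "finite_simplicial_complex (S_verts \<rho>) (S_faces \<rho>)"
proof -
  have pos: "0 < \<rho> ! i" if "i < length \<rho>" for i
    using assms that by (auto simp: positive_tuple_def)
  have down: "G \<in> S_faces \<rho>" if "F \<in> S_faces \<rho>" "G \<subseteq> F" for F G
  proof (cases "G = {}")
    case True
    then show ?thesis by (simp add: S_faces_def)
  next
    case False
    then obtain i where i: "i \<in> G" by blast
    have F: "F \<subseteq> {..<length \<rho>}" "(GCD i\<in>F. \<rho> ! i) > 1"
      using that False by (auto simp: S_faces_def)
    have dvd: "(GCD i\<in>F. \<rho> ! i) dvd (GCD i\<in>G. \<rho> ! i)"
      using that(2) by (intro Gcd_greatest) (auto intro: Gcd_dvd)
    have "i < length \<rho>" using i that(2) F(1) by auto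
    then have "(GCD i\<in>G. \<rho> ! i) \<noteq> 0"
      using pos[of i] i by (auto simp: Gcd_0_iff)
    then have "(GCD i\<in>G. \<rho> ! i) > 1"
      using dvd_imp_le[OF dvd] F(2) by linarith
    then show ?thesis using that(2) F(1) by (auto simp: S_faces_def)
  qed
  have "F \<subseteq> S_verts \<rho>" if "F \<in> S_faces \<rho>" for F
  proof
    fix i assume "i \<in> F"
    then have "{i} \<in> S_faces \<rho>" using down[OF that, of "{i}"] by simp
    then show "i \<in> S_verts \<rho>" by (auto simp: S_faces_def S_verts_def)
  qed
  moreover have "finite (S_verts \<rho>)" "{} \<in> S_faces \<rho>" "\<forall>v\<in>S_verts \<rho>. {v} \<in> S_faces \<rho>"
    by (auto simp: S_faces_def S_verts_def)
  ultimately show ?thesis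
    using down unfolding finite_simplicial_complex_def by blast
qed

end

theory Submission
  imports Defs "HOL-Computational_Algebra.Primes"
begin

text \<open>
  Choose pairwise distinct primes \<open>p F\<close>, one for each face \<open>F\<close>, and give the vertex \<open>v\<close> the label
  \<open>\<Prod>F\<ni>v. p F\<close>.  A prime dividing all labels of a nonempty vertex set \<open>I\<close> must be some \<open>p F\<close> with
  \<open>I \<subseteq> F\<close>, so the labels of \<open>I\<close> have a common factor exactly when \<open>I\<close> lies in a face.
\<close>

text \<open>There are infinitely many primes, so some set \<open>B\<close> of primes has exactly
  \<open>card A\<close> elements; any bijection from \<open>A\<close> onto \<open>B\<close> serves
  as \<open>p\<close>.\<close>

lemma distinct_primes:
  assumes "finite A"
  shows "\<exists>p :: 'a \<Rightarrow> nat. inj_on p A \<and> (\<forall>x\<in>A. prime (p x))"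
proof -
  obtain B :: "nat set" where B: "finite B" "card B = card A" "B \<subseteq> {p. prime p}"
    using infinite_arbitrarily_large[OF primes_infinite] by blast
  then obtain p where "bij_betw p A B"
    using finite_same_card_bij[OF assms] by metis
  then show ?thesis
    using B(3) by (auto simp: bij_betw_def)
qed

text \<open>A gcd equal to 0 would be divisible by every prime without exceeding 1; the positive
  element \<open>x\<close> excludes this case. A gcd other than 1 has a prime factor.\<close>

lemma Gcd_nat_gt_1_iff:
  fixes A :: "nat set"
  assumes "x \<in> A" "x > 0"
  shows "Gcd A > 1 \<longleftrightarrow> (\<exists>p. prime p \<and> (\<forall>a\<in>A. p dvd a))"
proof -
  have "Gcd A \<noteq> 0"
    using assms by (auto simp: Gcd_0_iff)
  then have "Gcd A > 1 \<longleftrightarrow> Gcd A \<noteq> 1"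
    by linarith
  also have "\<dots> \<longleftrightarrow> (\<exists>p. prime p \<and> p dvd Gcd A)"
    using prime_factor_nat by (metis nat_dvd_1_iff_1 not_prime_1)
  finally show ?thesis
    by (simp add: dvd_Gcd_iff)
qed

context
  fixes K :: "'a set set" and p :: "'a set \<Rightarrow> nat"
  assumes fin: "finite K" and inj: "inj_on p K" and pr: "\<And>F. F \<in> K \<Longrightarrow> prime (p F)"
begin

text \<open>A prime dividing a product divides one of its factors, and here each factor is itself
  prime, hence equal to \<open>q\<close>.\<close>

lemma prime_dvd_label_iff:
  assumes "prime q"
  shows "q dvd (\<Prod>F | F \<in> K \<and> v \<in> F. p F) \<longleftrightarrow> (\<exists>F\<in>K. v \<in> F \<and> q = p F)"
proof -
  have "q dvd (\<Prod>F | F \<in> K \<and> v \<in> F. p F) \<longleftrightarrow> (\<exists>F\<in>{F. F \<in> K \<and> v \<in> F}. q dvd p F)"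
    using fin assms by (intro prime_dvd_prod_iff) auto
  also have "\<dots> \<longleftrightarrow> (\<exists>F\<in>K. v \<in> F \<and> q = p F)"
    using primes_dvd_imp_eq[OF assms] pr by auto
  finally show ?thesis .
qed

lemma label_pos: "(\<Prod>F | F \<in> K \<and> v \<in> F. p F) > 0"
  by (intro prod_pos) (use pr prime_gt_0_nat in blast)

lemma Gcd_labels_gt_1_iff:
  assumes "I \<noteq> {}"
  shows "(GCD v\<in>I. \<Prod>F | F \<in> K \<and> v \<in> F. p F) > 1 \<longleftrightarrow> (\<exists>F\<in>K. I \<subseteq> F)"
proof -
  obtain v where v: "v \<in> I"
    using assms by blast
  have "(GCD v\<in>I. \<Prod>F | F \<in> K \<and> v \<in> F. p F) > 1 \<longleftrightarrow>
      (\<exists>q. prime q \<and> (\<forall>v\<in>I. q dvd (\<Prod>F | F \<in> K \<and> v \<in> F. p F)))"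
    using Gcd_nat_gt_1_iff[OF imageI[OF v] label_pos] by simp
  also have "\<dots> \<longleftrightarrow> (\<exists>q. prime q \<and> (\<forall>v\<in>I. \<exists>F\<in>K. v \<in> F \<and> q = p F))"
    by (simp add: prime_dvd_label_iff cong: conj_cong)
  also have "\<dots> \<longleftrightarrow> (\<exists>F\<in>K. I \<subseteq> F)"
  proof
    assume "\<exists>q. prime q \<and> (\<forall>v\<in>I. \<exists>F\<in>K. v \<in> F \<and> q = p F)"
    then obtain q where q: "\<forall>v\<in>I. \<exists>F\<in>K. v \<in> F \<and> q = p F"
      by (elim exE conjE)
    obtain F where F: "F \<in> K" "q = p F"
      using bspec[OF q v] by (elim bexE conjE)
    \<comment> \<open>The face \<open>F\<close> was found from the single vertex \<open>v\<close>.
      Any other \<open>w\<close> in \<open>I\<close> lies in some face \<open>G\<close> with the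
      same prime \<open>q\<close>, and injectivity of \<open>p\<close> forces
      \<open>G = F\<close>.\<close>
    have "I \<subseteq> F"
    proof
      fix w assume "w \<in> I"
      with q obtain G where "G \<in> K" "w \<in> G" "q = p G"
        by metis
      with F inj show "w \<in> F"
        by (metis inj_onD)
    qed
    with F(1) show "\<exists>F\<in>K. I \<subseteq> F" ..
  next
    assume "\<exists>F\<in>K. I \<subseteq> F"
    then obtain F where "F \<in> K" "I \<subseteq> F" ..
    then show "\<exists>q. prime q \<and> (\<forall>v\<in>I. \<exists>F\<in>K. v \<in> F \<and> q = p F)"
      using pr by (intro exI[of _ "p F"]) auto
  qed
  finally show ?thesis .
qed

end

theorem proposition3p15:
  fixes V :: "'a set" and K :: "'a set set"
  assumes "finite_simplicial_complex V K"
  shows "\<exists>\<rho>. positive_tuple \<rho> \<and> complex_isomorphic V K (S_verts \<rho>) (S_faces \<rho>)"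
proof -
  have finV: "finite V" and sub: "\<And>F. F \<in> K \<Longrightarrow> F \<subseteq> V" and empty: "{} \<in> K"
    and vert: "\<And>v. v \<in> V \<Longrightarrow> {v} \<in> K" and down: "\<And>F G. F \<in> K \<Longrightarrow> G \<subseteq> F \<Longrightarrow> G \<in> K"
    using assms by (simp_all add: finite_simplicial_complex_def)
  have finK: "finite K"
    by (rule finite_subset[of K "Pow V"]) (use finV sub in auto)
  obtain p :: "'a set \<Rightarrow> nat" where p: "inj_on p K" "\<And>F. F \<in> K \<Longrightarrow> prime (p F)"
    using distinct_primes[OF finK] by auto
  define a where "a v = (\<Prod>F | F \<in> K \<and> v \<in> F. p F)" for v
  have face: "(GCD v\<in>I. a v) > 1 \<longleftrightarrow> I \<in> K" if "I \<noteq> {}" for I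
  proof -
    have "(GCD v\<in>I. a v) > 1 \<longleftrightarrow> (\<exists>F\<in>K. I \<subseteq> F)"
      unfolding a_def using finK p that by (rule Gcd_labels_gt_1_iff)
    \<comment> \<open>Closure under subsets turns lying in a face into being a face.\<close>
    with down show ?thesis
      by auto
  qed
  have pos: "a v > 0" for v
    unfolding a_def by (rule label_pos[OF finK p])
  \<comment> \<open>The gcd over \<open>{v}\<close> is \<open>a v\<close> itself, and
    \<open>{v}\<close> is a face.\<close>
  have a_gt: "a v > 1" if "v \<in> V" for v
    using face[of "{v}"] vert[OF that] by simp
  obtain f where f: "bij_betw f V {..<card V}"
    using ex_bij_betw_finite_nat[OF finV] by (auto simp: atLeast0LessThan)
  \<comment> \<open>\<open>f\<close> numbers the vertices; \<open>e\<close> recovers the vertex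
    whose label is to stand at a given position of the tuple.\<close>
  define e where "e = inv_into V f"
  have ef: "e (f v) = v" if "v \<in> V" for v
    using f that by (simp add: e_def bij_betw_inv_into_left)
  have eV: "e i \<in> V" if "i < card V" for i
    using bij_betw_inv_into[OF f] that unfolding e_def bij_betw_def by blast
  have fV: "f v < card V" if "v \<in> V" for v
    using f that by (auto simp: bij_betw_def)
  text \<open>The trailing \<open>1\<close> adds no vertex; it keeps the tuple nonempty when \<open>V\<close> is empty.\<close>
  define \<rho> where "\<rho> = map (\<lambda>i. a (e i)) [0..<card V] @ [1]"
  have len: "length \<rho> = Suc (card V)"
    by (simp add: \<rho>_def)
  have nth: "\<rho> ! i = a (e i)" if "i < card V" for i
    using that by (simp add: \<rho>_def nth_append)
  have nth_last: "\<rho> ! card V = 1"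
    by (simp add: \<rho>_def nth_append)
  have "positive_tuple \<rho>"
    using pos by (auto simp: positive_tuple_def \<rho>_def)
  moreover have "S_verts \<rho> = {..<card V}"
    using nth nth_last a_gt[OF eV] by (auto simp: S_verts_def len less_Suc_eq)
  moreover have "F \<in> K \<longleftrightarrow> f ` F \<in> S_faces \<rho>" if "F \<subseteq> V" for F
  proof (cases "F = {}")
    case True
    then show ?thesis
      by (simp add: empty S_faces_def)
  next
    case False
    have "(\<lambda>i. \<rho> ! i) ` f ` F = a ` F"
      unfolding image_image using that nth fV ef by (intro image_cong) auto
    then show ?thesis
      using face[OF False] False that fV by (auto simp: S_faces_def len less_Suc_eq)
  qed
  ultimately show ?thesis
    using f by (intro exI[of _ \<rho>] conjI) (auto simp: complex_isomorphic_def)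
qed

end
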